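(* Let $G$ be a connected $d$-regular graph with $d\ge 3$ and edge connectivity $\kappa'<d$. Then \[ t(G)>\frac{d}{\lambda_2}-1\ge \frac{d}{\lambda}-1 . \]
   Context: All graphs are finite, undirected and simple. For a graph $G$ of order $n$, $\lambda_1\ge\lambda_2\ge\dots\ge\lambda_n$ denote the eigenvalues of its adjacency matrix (with multiplicity), and $\lambda=\max\{|\lambda_2|,|\lambda_n|\}$. The edge connectivity of $G$ is denoted $\kappa'=\kappa'(G)$, and $c(H)$ denotes the number of components of a graph $H$. The toughness of a connected graph $G$ is $t(G)=\min\left\{\frac{|S|}{c(G-S)}\right\}$, where the minimum is taken over all proper subsets $S\subset V(G)$ such that $c(G-S)>1$. *)

theory Defs
  imports
    "HOL-Library.Countable_Set"
    "HOL-Computational_Algebra.Polynomial"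
    "Jordan_Normal_Form.Char_Poly"
    "Graph_Theory.Digraph_Component"
begin

text \<open>
  A finite simple undirected graph is a digraph satisfying the locale predicate
  \<^const>\<open>graph\<close>: finite, loopfree, without parallel arcs, and symmetric. Every undirected edge is
  thus represented by two opposite arcs, so edges have to be counted as unordered pairs.
\<close>

definition edges :: "('a, 'b) pre_digraph \<Rightarrow> 'a set set" where
  "edges G = (\<lambda>e. {tail G e, head G e}) ` arcs G"

definition del_edges :: "('a, 'b) pre_digraph \<Rightarrow> 'a set set \<Rightarrow> ('a, 'b) pre_digraph" where
  "del_edges G F = G\<lparr>arcs := {e \<in> arcs G. {tail G e, head G e} \<notin> F}\<rparr>"

text \<open>
  In a symmetric digraph without parallel arcs, the out-degree of a vertex is the number of its
  neighbours.
\<close>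

definition regular :: "('a, 'b) pre_digraph \<Rightarrow> nat \<Rightarrow> bool" where
  "regular G d \<longleftrightarrow> (\<forall>v \<in> verts G. out_degree G v = d)"

text \<open>
  The minimum below is meaningful for graphs with at least two vertices; on a single vertex no
  edge set is disconnecting. The qualified name avoids topological connectedness.
\<close>

definition edge_connectivity :: "('a, 'b) pre_digraph \<Rightarrow> nat" where
  "edge_connectivity G =
     Min (card ` {F. F \<subseteq> edges G \<and> \<not> Digraph_Component.connected (del_edges G F)})"

text \<open>
  For symmetric digraphs, strongly connected components are the components of the undirected graph.
\<close>

definition num_components :: "('a, 'b) pre_digraph \<Rightarrow> nat" where
  "num_components H = card (pre_digraph.sccs H)"

text \<open>
  As in the usual definition, toughness has a meaningful value only if some vertex set is
  separating, i.e. if the graph is not complete (otherwise this is \<^term>\<open>Min {}\<close>).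
\<close>

definition toughness :: "('a, 'b) pre_digraph \<Rightarrow> real" where
  "toughness G =
     Min {real (card S) / real (num_components (G \<restriction> (verts G - S))) | S.
            S \<subset> verts G \<and> num_components (G \<restriction> (verts G - S)) > 1}"

text \<open>
  The adjacency matrix is taken with respect to \<^term>\<open>from_nat_into (verts G)\<close>, which for a finite
  vertex set of size \<open>n\<close> is a bijection from \<open>{..<n}\<close>. Its characteristic polynomial does
  not depend on the chosen enumeration.
\<close>

definition adjacency_matrix :: "('a, 'b) pre_digraph \<Rightarrow> real mat" where
  "adjacency_matrix G = mat (card (verts G)) (card (verts G))
     (\<lambda>(i, j). if from_nat_into (verts G) i \<rightarrow>\<^bsub>G\<^esub> from_nat_into (verts G) j then 1 else 0)"

text \<open>
  Eigenvalues with multiplicity, as roots of the characteristic polynomial (all of them are real,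
  as the matrix is symmetric), in decreasing order; \<open>eigval G i\<close> is \<open>\<lambda>\<^sub>i\<close>
  for \<open>1 \<le> i \<le> n\<close>.
\<close>

definition eigval :: "('a, 'b) pre_digraph \<Rightarrow> nat \<Rightarrow> real" where
  "eigval G i =
     rev (sorted_list_of_multiset (proots (char_poly (adjacency_matrix G)))) ! (i - 1)"

definition eigval_abs_max :: "('a, 'b) pre_digraph \<Rightarrow> real" where
  "eigval_abs_max G = max \<bar>eigval G 2\<bar> \<bar>eigval G (card (verts G))\<bar>"

end

theory Submission
  imports Defs
begin

text \<open>
  Write \<open>k\<close> for the edge connectivity. Two bounds meet at \<open>k\<close>.

  \<^item> If removing \<open>S\<close> leaves \<open>c > 1\<close> components, each of them is one side of an edge cut, so it
    sends at least \<open>k\<close> edges out, and all of these end in \<open>S\<close>. As \<open>S\<close> meets at most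
    \<open>d \<cdot> card S\<close> edges, \<open>k c \<le> d \<cdot> card S\<close>, and the toughness is at least \<open>k / d\<close>
    (\<open>toughness_ge_edge_connectivity\<close>).

  \<^item> A cut of \<open>k < d\<close> edges has more than \<open>d\<close> vertices on each side, because a vertex in a small side
    has too few neighbours there (\<open>small_cut_imp_large_side\<close>). Functions that are constant on each
    side have a Rayleigh quotient of at least \<open>d - k (1 / card A + 1 / card B)\<close>, so on this
    plane it is at least \<open>d - 2 k / (d + 1)\<close>; being two-dimensional, the plane forces \<open>\<lambda>\<^sub>2\<close> to be at
    least as large (\<open>second_eigenvalue_ge_cut\<close>).

  The second bound gives \<open>d / \<lambda>\<^sub>2 - 1 \<le> 2 k / (d (d + 1) - 2 k)\<close>, which lies below \<open>k / d\<close>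
  exactly when \<open>2 k < d (d - 1)\<close>; this follows from \<open>k < d\<close> and \<open>d \<ge> 3\<close>. Strictness needs
  \<open>k > 0\<close>, that is, connectedness. The second inequality of the theorem only says that
  \<open>\<lambda>\<^sub>2 > 0\<close> and \<open>\<lambda>\<^sub>2 \<le> \<lambda>\<close>.

  The spectral input is the upper half of the Courant-Fischer principle for the second eigenvalue,
  derived here from the orthogonal diagonalization of real symmetric matrices.
\<close>

section \<open>Real symmetric matrices\<close>

lemma symmetric_mat_scalar_prod:
  fixes A :: "'a :: comm_semiring_0 mat"
  assumes A: "A \<in> carrier_mat n n" and sym: "A\<^sup>T = A"
    and v: "v \<in> carrier_vec n" and w: "w \<in> carrier_vec n"
  shows "(A *\<^sub>v v) \<bullet> w = v \<bullet> (A *\<^sub>v w)"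
  using transpose_vec_mult_scalar[OF A w v] A v w sym
  by (metis comm_scalar_prod mult_mat_vec_carrier)

text \<open>
  The characteristic polynomial splits over the complex numbers, and every complex root \<open>a\<close> is
  real: for an eigenvector \<open>v\<close>, moving the matrix across \<open>v \<bullet> conjugate v\<close> gives \<open>a = cnj a\<close>.
\<close>
lemma real_symmetric_char_poly_splits:
  fixes A :: "real mat"
  assumes A: "A \<in> carrier_mat n n" and sym: "A\<^sup>T = A"
  shows "\<exists>es. char_poly A = (\<Prod>e\<leftarrow>es. [:- e, 1:])"
proof -
  let ?C = "map_mat complex_of_real A"
  have C: "?C \<in> carrier_mat n n" using A by simp
  have symC: "?C\<^sup>T = ?C" 
  proof -
    have "?C\<^sup>T = map_mat complex_of_real (A\<^sup>T)" by (rule eq_matI) auto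
    then show ?thesis by (simp add: sym)
  qed
  obtain as where as: "char_poly ?C = (\<Prod>a\<leftarrow>as. [:- a, 1:])"
    using char_poly_factorized[OF C] by blast
  have real: "complex_of_real (Re a) = a" if "a \<in> set as" for a
  proof -
    have "poly (char_poly ?C) a = 0" unfolding as using that by (rule linear_poly_root)
    then obtain v where "eigenvector ?C v a"
      using eigenvalue_root_char_poly[OF C] unfolding eigenvalue_def by blast
    then have v: "v \<in> carrier_vec n" "v \<noteq> 0\<^sub>v n" "?C *\<^sub>v v = a \<cdot>\<^sub>v v"
      using C unfolding eigenvector_def by auto
    have cv: "conjugate v \<in> carrier_vec n" using v by simp
    have "?C *\<^sub>v conjugate v = conjugate (?C *\<^sub>v v)"
      using A v(1) by (intro eq_vecI) (auto simp: scalar_prod_def conjugate_vec_def cnj_sum)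
    also have "\<dots> = cnj a \<cdot>\<^sub>v conjugate v"
      unfolding v(3) by (intro eq_vecI) auto
    finally have conj: "?C *\<^sub>v conjugate v = cnj a \<cdot>\<^sub>v conjugate v" .
    have "a * (v \<bullet> conjugate v) = (?C *\<^sub>v v) \<bullet> conjugate v"
      using v cv by simp
    also have "\<dots> = v \<bullet> (?C *\<^sub>v conjugate v)"
      by (rule symmetric_mat_scalar_prod[OF C symC v(1) cv])
    also have "\<dots> = cnj a * (v \<bullet> conjugate v)"
      unfolding conj using v cv by simp
    finally have "a = cnj a"
      using v conjugate_square_eq_0_vec[OF v(1)] by simp
    then show ?thesis by (metis Reals_cnj_iff of_real_Re)
  qed
  interpret of_real_poly: map_poly_inj_comm_ring_hom complex_of_real ..
  have "map_poly complex_of_real (char_poly A) = char_poly ?C"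
    by (rule of_real_hom.char_poly_hom[OF A, symmetric])
  also have "\<dots> = map_poly complex_of_real (\<Prod>e\<leftarrow>map Re as. [:- e, 1:])"
    unfolding as using real
  proof (induction as)
    case (Cons a as)
    then show ?case by (simp add: of_real_poly.hom_mult del: mult_pCons_left)
  qed simp
  finally have "char_poly A = (\<Prod>e\<leftarrow>map Re as. [:- e, 1:])"
    by (rule of_real_poly.injectivity)
  then show ?thesis by blast
qed

text \<open>
  A unit vector \<open>u\<close> is the image of the first basis vector under the reflection in the hyperplane
  orthogonal to \<open>w = e\<^sub>0 - u\<close>. This gives an orthogonal matrix with prescribed first column without
  any orthonormalization of a basis.
\<close>
lemma householder_reflection:
  fixes u :: "real vec"
  assumes u: "u \<in> carrier_vec (Suc n)" "u \<bullet> u = 1"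
  shows "\<exists>W \<in> carrier_mat (Suc n) (Suc n). W\<^sup>T = W \<and> W * W = 1\<^sub>m (Suc n) \<and>
    W *\<^sub>v unit_vec (Suc n) 0 = u"
proof (cases "u = unit_vec (Suc n) 0")
  case True
  then show ?thesis by (intro bexI[of _ "1\<^sub>m (Suc n)"]) auto
next
  case False
  let ?n = "Suc n"
  define w where "w = unit_vec ?n 0 - u"
  define q where "q = w $ 0"
  have w: "w \<in> carrier_vec ?n" using u by (simp add: w_def)
  \<comment> \<open>Since \<open>u\<close> is a unit vector, \<open>w \<bullet> w = 2 - 2 u\<^sub>0 = 2 w\<^sub>0\<close>, so the factor \<open>2 / (w \<bullet> w)\<close> of the
    reflection is \<open>1 / w\<^sub>0\<close>.\<close>
  have ww: "(\<Sum>i<?n. w $ i * w $ i) = 2 * q"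
  proof -
    have uu: "(\<Sum>i<?n. u $ i * u $ i) = 1"
      using u by (simp add: scalar_prod_def atLeast0LessThan)
    have "(\<Sum>i<?n. w $ i * w $ i) =
        (\<Sum>i<?n. (if i = 0 then 1 - 2 * u $ 0 else 0) + u $ i * u $ i)"
      using u by (intro sum.cong) (auto simp: w_def algebra_simps)
    also have "\<dots> = 2 * q"
      using u uu by (simp add: sum.distrib q_def w_def)
    finally show ?thesis .
  qed
  have q: "q \<noteq> 0"
  proof
    assume "q = 0"
    then have "\<forall>i\<in>{..<?n}. w $ i * w $ i = 0"
      using ww sum_nonneg_eq_0_iff[of "{..<?n}" "\<lambda>i. w $ i * w $ i"] by simp
    then have "\<forall>i<?n. w $ i = 0" by simp
    then have "u = unit_vec ?n 0"
      using u by (intro eq_vecI) (auto simp: w_def)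
    then show False using False by blast
  qed
  define W where "W = mat ?n ?n (\<lambda>(i, j). (if i = j then 1 else 0) - w $ i * w $ j / q)"
  have W: "W \<in> carrier_mat ?n ?n" by (simp add: W_def)
  have "W\<^sup>T = W" by (rule eq_matI) (auto simp: W_def)
  moreover have "W * W = 1\<^sub>m ?n"
  proof (rule eq_matI)
    fix i j assume "i < dim_row (1\<^sub>m ?n :: real mat)" "j < dim_col (1\<^sub>m ?n :: real mat)"
    then have ij: "i < ?n" "j < ?n" by auto
    have "(W * W) $$ (i, j) = (\<Sum>k<?n. ((if i = k then 1 else 0) - w $ i * w $ k / q) *
        ((if k = j then 1 else 0) - w $ k * w $ j / q))"
      using ij by (simp add: W_def scalar_prod_def atLeast0LessThan)
    also have "\<dots> = (\<Sum>k<?n. (if k = i then (if i = j then 1 else 0) else 0)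
        - (if k = i then w $ i * w $ j / q else 0) - (if k = j then w $ i * w $ j / q else 0)
        + w $ i * w $ j / q\<^sup>2 * (w $ k * w $ k))"
      by (intro sum.cong) (auto simp: algebra_simps power2_eq_square)
    also have "\<dots> = (if i = j then 1 else 0) - w $ i * w $ j / q - w $ i * w $ j / q
        + w $ i * w $ j / q\<^sup>2 * (2 * q)"
      using ij by (simp only: sum.distrib sum_subtractf sum_distrib_left[symmetric] ww) simp
    also have "\<dots> = 1\<^sub>m ?n $$ (i, j)"
      using q ij by (simp add: power2_eq_square)
    finally show "(W * W) $$ (i, j) = 1\<^sub>m ?n $$ (i, j)" .
  qed (auto simp: W_def)
  moreover have "W *\<^sub>v unit_vec ?n 0 = u"
  proof (rule eq_vecI)
    fix i assume "i < dim_vec u"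
    then have i: "i < ?n" using u by simp
    have "(W *\<^sub>v unit_vec ?n 0) $ i = W $$ (i, 0)"
      using i W by simp
    also have "\<dots> = (if i = 0 then 1 else 0) - w $ i"
      using i q by (simp add: W_def q_def[symmetric])
    also have "\<dots> = u $ i"
      using i u by (simp add: w_def)
    finally show "(W *\<^sub>v unit_vec ?n 0) $ i = u $ i" .
  qed (use u W in auto)
  ultimately show ?thesis using W by blast
qed

text \<open>
  Deflation: conjugating with a reflection that sends \<open>e\<^sub>0\<close> to a unit eigenvector for the first listed
  root \<open>e\<close> splits off a block \<open>e\<close>. Symmetry clears the first row along with the first column, so the
  remaining block is again symmetric, with the remaining roots. The roots appear on the diagonal
  in the order in which they are listed, so a sorted list may be prescribed.
\<close>
lemma real_symmetric_orthogonally_diagonalizable: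
  fixes A :: "real mat"
  assumes "A \<in> carrier_mat n n" "A\<^sup>T = A" "char_poly A = (\<Prod>e\<leftarrow>es. [:- e, 1:])"
  shows "\<exists>P \<in> carrier_mat n n. P\<^sup>T * P = 1\<^sub>m n \<and> P\<^sup>T * A * P = mat_diag n (\<lambda>i. es ! i)"
  using assms
proof (induction es arbitrary: n A)
  case Nil
  then have "n = 0" using degree_monic_char_poly[of A n] by simp
  then show ?case using Nil by (intro bexI[of _ "1\<^sub>m 0"]) (auto simp: mat_diag_def)
next
  case (Cons e es N A)
  note A = \<open>A \<in> carrier_mat N N\<close>
  have cp: "char_poly A = [:- e, 1:] * (\<Prod>e\<leftarrow>es. [:- e, 1:])" using Cons.prems by simp
  have "N \<noteq> 0"
  proof
    assume "N = 0"
    then have "degree (char_poly A) = 0" using degree_monic_char_poly[OF A] by simp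
    moreover have "degree (char_poly A) = Suc (length es)"
      using degree_linear_factors[of uminus "e # es"] Cons.prems(3) by simp
    ultimately show False by simp
  qed
  then obtain n where N: "N = Suc n" by (cases N) auto
  have "eigenvalue A e" unfolding eigenvalue_root_char_poly[OF A] cp by simp
  then obtain v where v: "v \<in> carrier_vec N" "v \<noteq> 0\<^sub>v N" "A *\<^sub>v v = e \<cdot>\<^sub>v v"
    using A unfolding eigenvalue_def eigenvector_def by auto
  have vv: "v \<bullet> v > 0"
    using v conjugate_square_greater_0_vec[OF v(1)] by simp
  define u where "u = (1 / sqrt (v \<bullet> v)) \<cdot>\<^sub>v v"
  have u: "u \<in> carrier_vec N" "A *\<^sub>v u = e \<cdot>\<^sub>v u" "u \<bullet> u = 1"
    using v vv A by (auto simp: u_def mult_mat_vec smult_smult_assoc mult.commute)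
  obtain W where W: "W \<in> carrier_mat N N" "W\<^sup>T = W" "W * W = 1\<^sub>m N"
      "W *\<^sub>v unit_vec N 0 = u"
    using householder_reflection[of u n] u N by auto
  define B where "B = W * A * W"
  have B: "B \<in> carrier_mat N N" using W A by (simp add: B_def)
  have symB: "B\<^sup>T = B"
    using W A Cons.prems(2) unfolding B_def
    by (simp add: transpose_mult[of _ N N _ N] assoc_mult_mat[of _ N N _ N _ N])
  have Wu: "W *\<^sub>v u = unit_vec N 0"
    using W(1,3) by (simp add: W(4)[symmetric] assoc_mult_mat_vec[of _ N N _ N, symmetric])
  have B0: "B *\<^sub>v unit_vec N 0 = e \<cdot>\<^sub>v unit_vec N 0"
    using W A u Wu unfolding B_def
    by (simp add: assoc_mult_mat_vec[of _ N N _ N] mult_mat_vec[of _ N N])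
  have Bi0: "B $$ (i, 0) = (if i = 0 then e else 0)" if "i < N" for i
    using arg_cong[OF B0, of "\<lambda>x. x $ i"] that B N by simp
  have B0i: "B $$ (0, i) = (if i = 0 then e else 0)" if "i < N" for i
    using Bi0[OF that] symB that B N by (metis carrier_matD index_transpose_mat(1) zero_less_Suc)
  define E where "E = mat 1 1 (\<lambda>_. e)"
  define D where "D = mat n n (\<lambda>(i, j). B $$ (Suc i, Suc j))"
  have E: "E \<in> carrier_mat 1 1" and D: "D \<in> carrier_mat n n" by (auto simp: E_def D_def)
  have Bblock: "B = four_block_mat E (0\<^sub>m 1 n) (0\<^sub>m n 1) D"
    using B N Bi0 B0i by (intro eq_matI) (auto simp: E_def D_def)
  have symD: "D\<^sup>T = D"
  proof (rule eq_matI)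
    fix i j assume "i < dim_row D" "j < dim_col D"
    then have "Suc i < N" "Suc j < N" "i < n" "j < n" using D N by auto
    then show "D\<^sup>T $$ (i, j) = D $$ (i, j)"
      using symB B by (simp add: D_def) (metis carrier_matD index_transpose_mat(1))
  qed (use D in auto)
  have "similar_mat B A"
    unfolding similar_mat_def similar_mat_wit_def Let_def using A B W
    by (intro exI[of _ W]) (auto simp: B_def)
  then have "char_poly A = char_poly B" by (simp add: char_poly_similar)
  also have "\<dots> = char_poly E * char_poly D"
    unfolding Bblock by (rule char_poly_four_block_zeros_col[OF E _ D]) simp
  also have "char_poly E = [:- e, 1:]"
    by (simp add: E_def char_poly_defs det_def sign_def)
  finally have "char_poly D = (\<Prod>e\<leftarrow>es. [:- e, 1:])"
    unfolding cp by (metis mult_cancel_left pCons_eq_0_iff zero_neq_one)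
  from Cons.IH[OF D symD this] obtain Q where Q: "Q \<in> carrier_mat n n" "Q\<^sup>T * Q = 1\<^sub>m n"
    "Q\<^sup>T * D * Q = mat_diag n (\<lambda>i. es ! i)" by blast
  define R where "R = four_block_mat (1\<^sub>m 1) (0\<^sub>m 1 n) (0\<^sub>m n 1) Q"
  have R: "R \<in> carrier_mat N N" 
    using four_block_carrier_mat[OF one_carrier_mat[of 1] Q(1)] by (simp add: R_def N)
  have RT: "R\<^sup>T = four_block_mat (1\<^sub>m 1) (0\<^sub>m 1 n) (0\<^sub>m n 1) (Q\<^sup>T)"
    unfolding R_def using Q by (subst transpose_four_block_mat) auto
  have RR: "R\<^sup>T * R = 1\<^sub>m N"
    unfolding RT unfolding R_def using Q
    by (subst mult_four_block_mat[of _ 1 1 _ n _ n _ _ 1 _ n]) (auto simp: N)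
  have RBR: "R\<^sup>T * B * R = four_block_mat E (0\<^sub>m 1 n) (0\<^sub>m n 1) (Q\<^sup>T * D * Q)"
    unfolding RT Bblock unfolding R_def using Q(1) E D
    by (simp add: mult_four_block_mat[of _ 1 1 _ n _ n _ _ 1 _ n])
  have diag: "\<dots> = mat_diag N (\<lambda>i. (e # es) ! i)"
    unfolding Q(3) by (rule eq_matI) (auto simp: E_def mat_diag_def N less_Suc_eq_0_disj split: if_splits)
  show ?case
  proof (intro bexI conjI)
    show WR: "W * R \<in> carrier_mat N N" using W R by simp
    have T: "(W * R)\<^sup>T = R\<^sup>T * W" using W R by (simp add: transpose_mult[of _ N N _ N])
    have "(W * R)\<^sup>T * (W * R) = R\<^sup>T * ((W * W) * R)"
      unfolding T using W(1) R by (simp add: assoc_mult_mat[of _ N N _ N _ N])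
    then show "(W * R)\<^sup>T * (W * R) = 1\<^sub>m N" using W R RR by simp
    have "(W * R)\<^sup>T * A * (W * R) = R\<^sup>T * B * R"
      unfolding T B_def using W(1) R A by (simp add: assoc_mult_mat[of _ N N _ N _ N])
    then show "(W * R)\<^sup>T * A * (W * R) = mat_diag N (\<lambda>i. (e # es) ! i)"
      using RBR diag by simp
  qed
qed

text \<open>
  The vector \<open>p\<close> is an eigenvector for the largest eigenvalue: in an orthonormal eigenbasis the
  quadratic form is a weighted sum of squares, and orthogonality to \<open>p\<close> removes the only coordinate
  whose weight may exceed \<open>es ! 1\<close>. A two-dimensional space always contains a nonzero \<open>x\<close> that is
  orthogonal to \<open>p\<close>, which is how lower bounds on \<open>es ! 1\<close> are obtained.
\<close>
lemma second_eigenvalue_bounds_quadratic_form: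
  fixes A :: "real mat"
  assumes A: "A \<in> carrier_mat n n" and sym: "A\<^sup>T = A"
    and cp: "char_poly A = (\<Prod>e\<leftarrow>es. [:- e, 1:])"
    and sorted: "sorted_wrt (\<ge>) es"
  shows "\<exists>p \<in> carrier_vec n. \<forall>x \<in> carrier_vec n. p \<bullet> x = 0 \<longrightarrow> x \<bullet> (A *\<^sub>v x) \<le> es ! 1 * (x \<bullet> x)"
proof (cases "n = 0")
  case True
  then show ?thesis by (intro bexI[of _ "0\<^sub>v n"]) (auto simp: scalar_prod_def)
next
  case False
  obtain P where P: "P \<in> carrier_mat n n" "P\<^sup>T * P = 1\<^sub>m n"
      "P\<^sup>T * A * P = mat_diag n (\<lambda>i. es ! i)"
    using real_symmetric_orthogonally_diagonalizable[OF A sym cp] by blast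
  have len: "length es = n"
    using degree_linear_factors[of uminus es] cp degree_monic_char_poly[OF A] by simp
  have PP: "P * P\<^sup>T = 1\<^sub>m n" using P mat_mult_left_right_inverse[of "P\<^sup>T" n P] by simp
  show ?thesis
  proof (intro bexI ballI impI)
    show "col P 0 \<in> carrier_vec n" using P by auto
    fix x assume x: "x \<in> carrier_vec n" and orth: "col P 0 \<bullet> x = 0"
    define y where "y = P\<^sup>T *\<^sub>v x"
    have y: "y \<in> carrier_vec n" using P x by (auto simp: y_def)
    have xy: "x = P *\<^sub>v y"
      unfolding y_def using P(1) x PP
      by (simp add: assoc_mult_mat_vec[of _ n n _ n, symmetric])
    have y0: "y $ 0 = 0" using orth P x False by (simp add: y_def)
    have iso: "(P *\<^sub>v a) \<bullet> b = a \<bullet> (P\<^sup>T *\<^sub>v b)" if "a \<in> carrier_vec n" "b \<in> carrier_vec n" for a b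
      using transpose_vec_mult_scalar[OF P(1) that] P(1) that
        comm_scalar_prod[of "P *\<^sub>v a" n b] comm_scalar_prod[of "P\<^sup>T *\<^sub>v b" n a]
      by simp
    have xx: "x \<bullet> x = (\<Sum>i<n. y $ i * y $ i)"
    proof -
      have "x \<bullet> x = y \<bullet> y" 
        using iso[OF y x] unfolding xy[symmetric] y_def[symmetric] .
      then show ?thesis using y by (simp add: scalar_prod_def atLeast0LessThan)
    qed
    have "x \<bullet> (A *\<^sub>v x) = y \<bullet> (P\<^sup>T *\<^sub>v (A *\<^sub>v x))"
      using iso[OF y, of "A *\<^sub>v x"] xy A x by simp
    also have "P\<^sup>T *\<^sub>v (A *\<^sub>v x) = (P\<^sup>T * A * P) *\<^sub>v y"
      unfolding xy using P(1) A y
      by (simp add: assoc_mult_mat_vec[of _ n n _ n])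
    also have "\<dots> = vec n (\<lambda>i. es ! i * y $ i)"
      unfolding P(3) using y
      by (intro eq_vecI) (auto simp: scalar_prod_def mat_diag_def atLeast0LessThan
        if_distrib[of "\<lambda>a. a * _"] cong: if_cong)
    also have "y \<bullet> \<dots> = (\<Sum>i<n. es ! i * (y $ i * y $ i))"
      by (simp add: scalar_prod_def atLeast0LessThan mult_ac)
    also have "\<dots> \<le> (\<Sum>i<n. es ! 1 * (y $ i * y $ i))"
    proof (rule sum_mono)
      fix i assume i: "i \<in> {..<n}"
      show "es ! i * (y $ i * y $ i) \<le> es ! 1 * (y $ i * y $ i)"
      proof (cases "i \<le> 1")
        case True
        then show ?thesis using y0 by (cases i) auto
      next
        case False
        then have "es ! i \<le> es ! 1" using sorted i len by (simp add: sorted_wrt_iff_nth_less)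
        then show ?thesis by (intro mult_right_mono) auto
      qed
    qed
    also have "\<dots> = es ! 1 * (x \<bullet> x)" unfolding xx by (simp add: sum_distrib_left)
    finally show "x \<bullet> (A *\<^sub>v x) \<le> es ! 1 * (x \<bullet> x)" .
  qed
qed

text \<open>
  Brings the list that defines the eigenvalues of a graph into the form that the two preceding
  results expect.
\<close>
lemma char_poly_eq_prod_sorted_roots:
  fixes A :: "real mat"
  assumes "A \<in> carrier_mat n n" "A\<^sup>T = A"
  shows "char_poly A = (\<Prod>e\<leftarrow>rev (sorted_list_of_multiset (proots (char_poly A))). [:- e, 1:])"
proof -
  obtain es where es: "char_poly A = (\<Prod>e\<leftarrow>es. [:- e, 1:])"
    using real_symmetric_char_poly_splits[OF assms] by blast
  have nz: "(\<Prod>e\<leftarrow>es. [:- e, 1:]) \<noteq> 0" for es :: "real list"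
    by (auto simp: prod_list_zero_iff)
  have "proots (\<Prod>e\<leftarrow>es. [:- e, 1:]) = mset es"
  proof (induction es)
    case (Cons e es)
    then show ?case using nz[of es] by (simp add: proots_mult del: mult_pCons_left)
  qed simp
  then have perm: "mset es = mset (rev (sorted_list_of_multiset (proots (char_poly A))))"
    by (simp add: es)
  have "prod_list (map f xs) = prod_list (map f ys)" if "mset xs = mset ys"
    for f :: "real \<Rightarrow> real poly" and xs ys
    unfolding prod_mset_prod_list[symmetric] mset_map that by (rule refl)
  from this[OF perm] show ?thesis by (rule trans[OF es])
qed

section \<open>Edge cuts and edge connectivity\<close>

text \<open>
  Each edge of the cut is represented once, by its arc that leaves \<open>A\<close>.
\<close>
definition edge_cut :: "('a, 'b) pre_digraph \<Rightarrow> 'a set \<Rightarrow> ('a \<times> 'a) set" where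
  "edge_cut G A = {(u, v) \<in> arcs_ends G. u \<in> A \<and> v \<notin> A}"

lemma arcs_ends_del_edges:
  "arcs_ends (del_edges G F) = {(u, v) \<in> arcs_ends G. {u, v} \<notin> F}"
  unfolding arcs_ends_conv del_edges_def by auto

lemma arcs_ends_induce_subgraph:
  "arcs_ends (G \<restriction> W) = {(u, v) \<in> arcs_ends G. u \<in> W \<and> v \<in> W}"
  unfolding arcs_ends_conv by auto

context graph
begin

lemma finite_arcs_ends: "finite (arcs_ends G)"
  by (simp add: arcs_ends_def)

lemma finite_edge_cut: "finite (edge_cut G A)"
  by (rule finite_subset[OF _ finite_arcs_ends]) (auto simp: edge_cut_def)

lemma dominates_sym: "u \<rightarrow>\<^bsub>G\<^esub> v \<longleftrightarrow> v \<rightarrow>\<^bsub>G\<^esub> u"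
  using graph_symmetric by blast

lemma neighbours_subset_verts: "{v. u \<rightarrow>\<^bsub>G\<^esub> v} \<subseteq> verts G - {u}"
  by (auto dest: adj_in_verts adj_not_same)

lemma finite_neighbours: "finite {v. u \<rightarrow>\<^bsub>G\<^esub> v}"
  by (rule finite_subset[OF neighbours_subset_verts]) simp

lemma card_neighbours: "card {v. u \<rightarrow>\<^bsub>G\<^esub> v} = out_degree G u"
proof -
  have "inj_on (head G) (out_arcs G u)"
    by (auto intro!: inj_onI no_multi_arcs simp: arc_to_ends_def)
  moreover have "head G ` out_arcs G u = {v. u \<rightarrow>\<^bsub>G\<^esub> v}"
    by (auto simp: arcs_ends_conv)
  ultimately show ?thesis unfolding out_degree_def by (metis card_image)
qed

lemma card_edge_cut: "card (edge_cut G A) = (\<Sum>u\<in>A \<inter> verts G. card {v. u \<rightarrow>\<^bsub>G\<^esub> v \<and> v \<notin> A})"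
proof -
  have "edge_cut G A = Sigma (A \<inter> verts G) (\<lambda>u. {v. u \<rightarrow>\<^bsub>G\<^esub> v \<and> v \<notin> A})"
    by (auto simp: edge_cut_def dest: adj_in_verts)
  moreover have "finite {v. u \<rightarrow>\<^bsub>G\<^esub> v \<and> v \<notin> A}" for u
    by (rule finite_subset[OF _ finite_neighbours[of u]]) auto
  ultimately show ?thesis by simp
qed

lemma edge_cut_complement: "edge_cut G (verts G - A) = prod.swap ` edge_cut G A"
proof
  show "edge_cut G (verts G - A) \<subseteq> prod.swap ` edge_cut G A"
  proof
    fix p assume "p \<in> edge_cut G (verts G - A)"
    then have "prod.swap p \<in> edge_cut G A"
      by (auto simp: edge_cut_def dest: adj_in_verts graph_symmetric)
    then show "p \<in> prod.swap ` edge_cut G A" by (metis imageI swap_swap)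
  qed
qed (auto simp: edge_cut_def dest: adj_in_verts graph_symmetric)

lemma card_edge_cut_complement: "card (edge_cut G (verts G - A)) = card (edge_cut G A)"
  unfolding edge_cut_complement by (rule card_image) (auto intro: inj_onI)

text \<open>
  For the forward direction, \<open>A\<close> is the set of vertices that one fixed vertex still reaches after
  the deletion; conversely, a walk that starts in \<open>A\<close> cannot leave it once the cut is deleted.
\<close>
lemma not_connected_del_edges_iff:
  assumes "verts G \<noteq> {}"
  shows "\<not> Digraph_Component.connected (del_edges G F) \<longleftrightarrow>
    (\<exists>A. A \<noteq> {} \<and> A \<subset> verts G \<and> (\<lambda>(u, v). {u, v}) ` edge_cut G A \<subseteq> F)"
proof -
  let ?H = "del_edges G F"
  have vH: "verts ?H = verts G" by (simp add: del_edges_def)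
  interpret H: wf_digraph ?H by unfold_locales (auto simp: del_edges_def)
  have "symmetric ?H"
    unfolding symmetric_def arcs_ends_del_edges
    by (auto intro!: symI dest: graph_symmetric simp: insert_commute)
  then have conn: "Digraph_Component.connected ?H \<longleftrightarrow>
      (\<forall>u\<in>verts G. \<forall>v\<in>verts G. u \<rightarrow>\<^sup>*\<^bsub>?H\<^esub> v)"
    using assms vH H.reachable_mk_symmetric_eq
    by (simp add: Digraph_Component.connected_def strongly_connected_def)
  show ?thesis
  proof
    assume "\<not> Digraph_Component.connected ?H"
    then obtain u v where uv: "u \<in> verts G" "v \<in> verts G" "\<not> u \<rightarrow>\<^sup>*\<^bsub>?H\<^esub> v"
      using conn by blast
    let ?A = "{w. u \<rightarrow>\<^sup>*\<^bsub>?H\<^esub> w}"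
    have "u \<in> ?A" using uv vH by simp
    moreover have "?A \<subseteq> verts G" using H.reachable_in_verts(2) vH by blast
    moreover have "(\<lambda>(x, y). {x, y}) ` edge_cut G ?A \<subseteq> F"
    proof clarify
      fix x y assume "(x, y) \<in> edge_cut G ?A"
      then have xy: "x \<rightarrow>\<^bsub>G\<^esub> y" "u \<rightarrow>\<^sup>*\<^bsub>?H\<^esub> x" "\<not> u \<rightarrow>\<^sup>*\<^bsub>?H\<^esub> y"
        by (auto simp: edge_cut_def)
      then have "(x, y) \<notin> arcs_ends ?H" using H.reachable_adj_trans by blast
      then show "{x, y} \<in> F" using xy(1) by (simp add: arcs_ends_del_edges)
    qed
    ultimately show "\<exists>A. A \<noteq> {} \<and> A \<subset> verts G \<and> (\<lambda>(u, v). {u, v}) ` edge_cut G A \<subseteq> F"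
      using uv by (intro exI[of _ ?A]) blast
  next
    assume "\<exists>A. A \<noteq> {} \<and> A \<subset> verts G \<and> (\<lambda>(u, v). {u, v}) ` edge_cut G A \<subseteq> F"
    then obtain A u v where A: "A \<subset> verts G" "(\<lambda>(u, v). {u, v}) ` edge_cut G A \<subseteq> F"
      and uv: "u \<in> A" "v \<in> verts G" "v \<notin> A" by blast
    have "w \<in> A" if "u \<rightarrow>\<^sup>*\<^bsub>?H\<^esub> w" for w
      using that
    proof (induction rule: H.reachable_induct)
      case (step x y)
      then have "x \<rightarrow>\<^bsub>G\<^esub> y" "{x, y} \<notin> F" by (auto simp: arcs_ends_del_edges)
      then show ?case using A(2) step.IH by (auto simp: edge_cut_def)
    qed (use uv in simp)
    then show "\<not> Digraph_Component.connected ?H" using conn uv A by blast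
  qed
qed

lemma card_edge_set_of_cut: "card ((\<lambda>(u, v). {u, v}) ` edge_cut G A) = card (edge_cut G A)"
  by (rule card_image) (auto intro!: inj_onI simp: edge_cut_def doubleton_eq_iff)

lemma edge_connectivity_le_cut:
  assumes "A \<noteq> {}" "A \<subset> verts G"
  shows "edge_connectivity G \<le> card (edge_cut G A)"
  unfolding edge_connectivity_def
proof (rule Min_le)
  let ?F = "(\<lambda>(u, v). {u, v}) ` edge_cut G A"
  have fin: "finite (edges G)" by (simp add: edges_def)
  show "finite (card ` {F. F \<subseteq> edges G \<and> \<not> Digraph_Component.connected (del_edges G F)})"
    by (rule finite_imageI, rule finite_subset[of _ "Pow (edges G)"]) (use fin in auto)
  have "?F \<subseteq> edges G" by (auto simp: edge_cut_def edges_def arcs_ends_conv)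
  moreover have "\<not> Digraph_Component.connected (del_edges G ?F)"
    using assms by (subst not_connected_del_edges_iff) auto
  ultimately show "card (edge_cut G A) \<in>
      card ` {F. F \<subseteq> edges G \<and> \<not> Digraph_Component.connected (del_edges G F)}"
    using card_edge_set_of_cut[of A] by (intro image_eqI[of _ _ ?F]) auto
qed

text \<open>
  Two distinct vertices ensure that some edge set disconnects the graph, so that the minimum
  ranges over a nonempty set. A minimum disconnecting set contains a cut, hence is no smaller.
\<close>
lemma edge_connectivity_attained_by_cut:
  assumes "u \<in> verts G" "v \<in> verts G" "u \<noteq> v"
  shows "\<exists>A. A \<noteq> {} \<and> A \<subset> verts G \<and> card (edge_cut G A) = edge_connectivity G"
proof -
  let ?\<F> = "{F. F \<subseteq> edges G \<and> \<not> Digraph_Component.connected (del_edges G F)}"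
  have fin: "finite (edges G)" by (simp add: edges_def)
  have ne: "verts G \<noteq> {}" using assms by auto
  have "(\<lambda>(u, v). {u, v}) ` edge_cut G {u} \<subseteq> edges G"
    by (auto simp: edge_cut_def edges_def arcs_ends_conv)
  moreover have "\<not> Digraph_Component.connected (del_edges G (edges G))"
    unfolding not_connected_del_edges_iff[OF ne]
    using assms calculation by (intro exI[of _ "{u}"]) auto
  ultimately have "edges G \<in> ?\<F>" by blast
  moreover have "finite ?\<F>"
    by (rule finite_subset[of _ "Pow (edges G)"]) (use fin in auto)
  ultimately have "edge_connectivity G \<in> card ` ?\<F>"
    unfolding edge_connectivity_def by (intro Min_in) blast+
  then obtain F where "edge_connectivity G = card F" "F \<in> ?\<F>" by (rule imageE)
  then have F: "F \<subseteq> edges G" "\<not> Digraph_Component.connected (del_edges G F)"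
    "card F = edge_connectivity G" by simp_all
  obtain A where A: "A \<noteq> {}" "A \<subset> verts G" "(\<lambda>(u, v). {u, v}) ` edge_cut G A \<subseteq> F"
    using iffD1[OF not_connected_del_edges_iff[OF ne] F(2)] by (elim exE conjE)
  have "card (edge_cut G A) \<le> card F"
    using card_mono[OF finite_subset[OF F(1) fin] A(3)] card_edge_set_of_cut by simp
  then have "card (edge_cut G A) = edge_connectivity G"
    using edge_connectivity_le_cut[OF A(1,2)] F(3) by simp
  then show ?thesis using A(1,2) by blast
qed

lemma connected_imp_edge_cut_nonempty:
  assumes "Digraph_Component.connected G" "A \<noteq> {}" "A \<subset> verts G"
  shows "edge_cut G A \<noteq> {}"
proof
  assume "edge_cut G A = {}"
  then have "\<not> Digraph_Component.connected (del_edges G {})"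
    using assms(2,3) by (subst not_connected_del_edges_iff) auto
  then show False using assms(1) by (simp add: del_edges_def)
qed

text \<open>
  A vertex of \<open>A\<close> has at most \<open>a - 1\<close> neighbours in \<open>A\<close>, where \<open>a\<close> is the size of \<open>A\<close>, so the cut
  has at least \<open>a (d - a + 1)\<close> edges. This is at least \<open>d\<close> for \<open>1 \<le> a \<le> d\<close>.
\<close>
lemma small_cut_imp_large_side:
  assumes reg: "regular G d" and A: "A \<noteq> {}" "A \<subseteq> verts G" and cut: "card (edge_cut G A) < d"
  shows "d < card A"
proof (rule ccontr)
  assume "\<not> d < card A"
  then have le: "card A \<le> d" by simp
  have finA: "finite A" using finite_subset[OF A(2)] by simp
  then have a: "card A > 0" using A by auto
  have "d - (card A - 1) \<le> card {v. u \<rightarrow>\<^bsub>G\<^esub> v \<and> v \<notin> A}" if "u \<in> A" for u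
  proof -
    have "d = card {v. u \<rightarrow>\<^bsub>G\<^esub> v}" using that reg A card_neighbours by (auto simp: regular_def)
    also have "\<dots> \<le> card ({v. u \<rightarrow>\<^bsub>G\<^esub> v \<and> v \<notin> A} \<union> (A - {u}))"
      using finA finite_neighbours[of u] neighbours_subset_verts[of u]
      by (intro card_mono) auto
    also have "\<dots> \<le> card {v. u \<rightarrow>\<^bsub>G\<^esub> v \<and> v \<notin> A} + card (A - {u})" by (rule card_Un_le)
    also have "card (A - {u}) = card A - 1" using that finA by simp
    finally show ?thesis by simp
  qed
  then have "of_nat (card A) * (d - (card A - 1)) \<le> (\<Sum>u\<in>A. card {v. u \<rightarrow>\<^bsub>G\<^esub> v \<and> v \<notin> A})"
    by (rule sum_bounded_below)
  then have "card A * (d - (card A - 1)) \<le> card (edge_cut G A)"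
    unfolding card_edge_cut using A(2) by (simp only: Int_absorb2 of_nat_id)
  moreover have "d \<le> card A * (d - (card A - 1))"
  proof -
    obtain a where a: "card A = Suc a" using a by (cases "card A") auto
    obtain k where k: "d = Suc a + k" using le a by (metis le_iff_add)
    show ?thesis unfolding a k by simp
  qed
  ultimately show False using cut by simp
qed

section \<open>The second eigenvalue and edge cuts\<close>

lemma sum_arcs_ends:
  "(\<Sum>(u, v)\<in>arcs_ends G. g u v) = (\<Sum>u\<in>verts G. \<Sum>v\<in>{v. u \<rightarrow>\<^bsub>G\<^esub> v}. g u v)"
proof -
  have "arcs_ends G = Sigma (verts G) (\<lambda>u. {v. u \<rightarrow>\<^bsub>G\<^esub> v})" (is "_ = ?S")
    by (auto dest: adj_in_verts)
  moreover have "(\<Sum>u\<in>verts G. \<Sum>v\<in>{v. u \<rightarrow>\<^bsub>G\<^esub> v}. g u v) = (\<Sum>(u, v)\<in>?S. g u v)"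
    by (rule sum.Sigma) (auto intro: finite_neighbours)
  ultimately show ?thesis by presburger
qed

lemma sum_arcs_ends_swap: "(\<Sum>(u, v)\<in>arcs_ends G. g u v) = (\<Sum>(u, v)\<in>arcs_ends G. g v u)"
  by (rule sum.reindex_bij_witness[of _ prod.swap prod.swap]) (auto dest: graph_symmetric)

lemma sum_arcs_ends_regular:
  fixes g :: "'a \<Rightarrow> real"
  assumes "regular G d"
  shows "(\<Sum>(u, v)\<in>arcs_ends G. g u) = d * (\<Sum>u\<in>verts G. g u)"
proof -
  have "(\<Sum>(u, v)\<in>arcs_ends G. g u) = (\<Sum>u\<in>verts G. \<Sum>v\<in>{v. u \<rightarrow>\<^bsub>G\<^esub> v}. g u)"
    by (rule sum_arcs_ends)
  also have "\<dots> = (\<Sum>u\<in>verts G. d * g u)"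
    using assms by (intro sum.cong) (auto simp: card_neighbours regular_def)
  finally show ?thesis by (simp add: sum_distrib_left)
qed

text \<open>
  This is \<open>A = d I - L\<close> for the Laplacian \<open>L\<close>; the factor one half is there because every edge
  contributes two arcs.
\<close>
lemma regular_quadratic_form:
  fixes f :: "'a \<Rightarrow> real"
  assumes "regular G d"
  shows "(\<Sum>(u, v)\<in>arcs_ends G. f u * f v) =
    d * (\<Sum>u\<in>verts G. (f u)\<^sup>2) - (\<Sum>(u, v)\<in>arcs_ends G. (f u - f v)\<^sup>2) / 2"
proof -
  have "(\<Sum>(u, v)\<in>arcs_ends G. (f u - f v)\<^sup>2) =
      (\<Sum>(u, v)\<in>arcs_ends G. (f u)\<^sup>2) + (\<Sum>(u, v)\<in>arcs_ends G. (f v)\<^sup>2)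
      - 2 * (\<Sum>(u, v)\<in>arcs_ends G. f u * f v)"
    unfolding sum_distrib_left sum.distrib[symmetric] sum_subtractf[symmetric]
    by (intro sum.cong) (auto simp: power2_diff)
  also have "(\<Sum>(u, v)\<in>arcs_ends G. (f v)\<^sup>2) = (\<Sum>(u, v)\<in>arcs_ends G. (f u)\<^sup>2)"
    by (rule sum_arcs_ends_swap)
  finally show ?thesis
    unfolding sum_arcs_ends_regular[OF assms, of "\<lambda>u. (f u)\<^sup>2"]
    by (simp add: diff_divide_distrib)
qed

text \<open>
  For a function that is constant on both sides, only the cut edges contribute to the Laplacian.
\<close>
lemma cut_quadratic_form:
  fixes \<alpha> \<beta> :: real
  assumes reg: "regular G d" and A: "A \<subseteq> verts G"
  defines "f \<equiv> \<lambda>u. if u \<in> A then \<alpha> else \<beta>"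
  shows "(\<Sum>u\<in>verts G. (f u)\<^sup>2) = card A * \<alpha>\<^sup>2 + card (verts G - A) * \<beta>\<^sup>2"
    and "(\<Sum>(u, v)\<in>arcs_ends G. f u * f v) =
      d * (card A * \<alpha>\<^sup>2 + card (verts G - A) * \<beta>\<^sup>2) - card (edge_cut G A) * (\<alpha> - \<beta>)\<^sup>2"
proof -
  let ?B = "verts G - A"
  show sq: "(\<Sum>u\<in>verts G. (f u)\<^sup>2) = card A * \<alpha>\<^sup>2 + card ?B * \<beta>\<^sup>2"
    using sum.subset_diff[OF A, of "\<lambda>u. (f u)\<^sup>2"] by (simp add: f_def)
  have disj: "edge_cut G A \<inter> edge_cut G ?B = {}" by (auto simp: edge_cut_def)
  have "(\<Sum>(u, v)\<in>arcs_ends G. (f u - f v)\<^sup>2) =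
      (\<Sum>(u, v)\<in>edge_cut G A \<union> edge_cut G ?B. (f u - f v)\<^sup>2)"
  proof (rule sum.mono_neutral_right[OF finite_arcs_ends])
    show "\<forall>p \<in> arcs_ends G - (edge_cut G A \<union> edge_cut G ?B). (case p of (u, v) \<Rightarrow> (f u - f v)\<^sup>2) = 0"
    proof
      fix p assume p: "p \<in> arcs_ends G - (edge_cut G A \<union> edge_cut G ?B)"
      obtain u v where uv: "p = (u, v)" by fastforce
      then have "u \<in> A \<longleftrightarrow> v \<in> A"
        using p adj_in_verts[of u v] by (auto simp: edge_cut_def)
      then show "(case p of (u, v) \<Rightarrow> (f u - f v)\<^sup>2) = 0" by (simp add: f_def uv)
    qed
  qed (auto simp: edge_cut_def)
  also have "\<dots> = (\<Sum>(u, v)\<in>edge_cut G A. (\<alpha> - \<beta>)\<^sup>2) + (\<Sum>(u, v)\<in>edge_cut G ?B. (\<alpha> - \<beta>)\<^sup>2)"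
    unfolding sum.union_disjoint[OF finite_edge_cut finite_edge_cut disj]
    by (intro arg_cong2[where f = "(+)"] sum.cong)
      (auto simp: edge_cut_def f_def power2_commute)
  also have "\<dots> = 2 * (card (edge_cut G A) * (\<alpha> - \<beta>)\<^sup>2)"
    using card_edge_cut_complement[of A] by (simp add: case_prod_unfold)
  finally show "(\<Sum>(u, v)\<in>arcs_ends G. f u * f v) =
      d * (card A * \<alpha>\<^sup>2 + card ?B * \<beta>\<^sup>2) - card (edge_cut G A) * (\<alpha> - \<beta>)\<^sup>2"
    unfolding regular_quadratic_form[OF reg] sq by simp
qed

lemma adjacency_matrix_carrier: "adjacency_matrix G \<in> carrier_mat (card (verts G)) (card (verts G))"
  by (simp add: adjacency_matrix_def)

lemma adjacency_matrix_symmetric: "(adjacency_matrix G)\<^sup>T = adjacency_matrix G"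
  by (rule eq_matI) (auto simp: adjacency_matrix_def dominates_sym)

lemma sum_enumerated_verts:
  "(\<Sum>i<card (verts G). g (from_nat_into (verts G) i)) = sum g (verts G)"
  by (rule sum.reindex_bij_betw[OF bij_betw_from_nat_into_finite]) simp

lemma adjacency_matrix_quadratic_form:
  fixes f :: "'a \<Rightarrow> real"
  defines "x \<equiv> vec (card (verts G)) (\<lambda>i. f (from_nat_into (verts G) i))"
  shows "x \<bullet> (adjacency_matrix G *\<^sub>v x) = (\<Sum>(u, v)\<in>arcs_ends G. f u * f v)"
    and "x \<bullet> x = (\<Sum>u\<in>verts G. (f u)\<^sup>2)"
proof -
  let ?n = "card (verts G)" and ?w = "from_nat_into (verts G)"
  show "x \<bullet> x = (\<Sum>u\<in>verts G. (f u)\<^sup>2)"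
    unfolding sum_enumerated_verts[symmetric]
    by (simp add: x_def scalar_prod_def atLeast0LessThan power2_eq_square)
  have "x \<bullet> (adjacency_matrix G *\<^sub>v x) =
      (\<Sum>i<?n. f (?w i) * (\<Sum>j<?n. (if ?w i \<rightarrow>\<^bsub>G\<^esub> ?w j then 1 else 0) * f (?w j)))"
    by (simp add: x_def adjacency_matrix_def scalar_prod_def atLeast0LessThan)
  also have "\<dots> = (\<Sum>u\<in>verts G. f u * (\<Sum>v\<in>verts G. (if u \<rightarrow>\<^bsub>G\<^esub> v then 1 else 0) * f v))"
    by (subst sum_enumerated_verts, subst sum_enumerated_verts) (rule refl)
  also have "\<dots> = (\<Sum>u\<in>verts G. \<Sum>v\<in>{v. u \<rightarrow>\<^bsub>G\<^esub> v}. f u * f v)"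
  proof (rule sum.cong)
    fix u
    have "(\<Sum>v\<in>verts G. (if u \<rightarrow>\<^bsub>G\<^esub> v then 1 else 0) * f v) = (\<Sum>v\<in>{v. u \<rightarrow>\<^bsub>G\<^esub> v}. f v)"
      using neighbours_subset_verts[of u] by (intro sum.mono_neutral_cong_right) auto
    then show "f u * (\<Sum>v\<in>verts G. (if u \<rightarrow>\<^bsub>G\<^esub> v then 1 else 0) * f v) = (\<Sum>v\<in>{v. u \<rightarrow>\<^bsub>G\<^esub> v}. f u * f v)"
      by (simp add: sum_distrib_left)
  qed simp
  also have "\<dots> = (\<Sum>(u, v)\<in>arcs_ends G. f u * f v)"
    by (rule sum_arcs_ends[symmetric])
  finally show "x \<bullet> (adjacency_matrix G *\<^sub>v x) = (\<Sum>(u, v)\<in>arcs_ends G. f u * f v)" .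
qed

text \<open>
  The functions that are constant on \<open>A\<close> and on its complement form a plane, so one of them is
  nonzero and orthogonal to the leading eigenvector. The Cauchy-Schwarz inequality
  \<open>(\<alpha> - \<beta>)\<^sup>2 \<le> (1 / a + 1 / b) (a \<alpha>\<^sup>2 + b \<beta>\<^sup>2)\<close> bounds its Rayleigh quotient from below.
\<close>
lemma second_eigenvalue_ge_cut:
  assumes reg: "regular G d" and A: "A \<noteq> {}" "A \<subset> verts G"
  shows "d - card (edge_cut G A) * (1 / card A + 1 / card (verts G - A)) \<le> eigval G 2"
proof -
  let ?n = "card (verts G)" and ?w = "from_nat_into (verts G)"
  define es where "es = rev (sorted_list_of_multiset (proots (char_poly (adjacency_matrix G))))"
  have sorted: "sorted_wrt (\<ge>) es" by (simp add: es_def sorted_wrt_rev)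
  obtain p where p: "p \<in> carrier_vec ?n"
    "\<And>x. x \<in> carrier_vec ?n \<Longrightarrow> p \<bullet> x = 0 \<Longrightarrow>
      x \<bullet> (adjacency_matrix G *\<^sub>v x) \<le> es ! 1 * (x \<bullet> x)"
    using second_eigenvalue_bounds_quadratic_form[OF adjacency_matrix_carrier
        adjacency_matrix_symmetric char_poly_eq_prod_sorted_roots[OF adjacency_matrix_carrier
          adjacency_matrix_symmetric] sorted[unfolded es_def]]
    unfolding es_def by blast
  define a b m where "a = real (card A)" and "b = real (card (verts G - A))"
    and "m = real (card (edge_cut G A))"
  have fin: "finite A" using A finite_subset[of A "verts G"] by auto
  have ab: "a > 0" "b > 0" using A fin by (auto simp: a_def b_def card_gt_0_iff)
  define s t where "s = (\<Sum>i<?n. if ?w i \<in> A then p $ i else 0)"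
    and "t = (\<Sum>i<?n. if ?w i \<in> A then 0 else p $ i)"
  obtain \<alpha> \<beta> :: real where ne: "\<alpha> \<noteq> 0 \<or> \<beta> \<noteq> 0" and orth: "\<alpha> * s + \<beta> * t = 0"
  proof (cases "t = 0 \<and> s = 0")
    case False
    then show ?thesis using that[of t "- s"] by auto
  qed (use that[of 1 1] in auto)
  define f where "f u = (if u \<in> A then \<alpha> else \<beta>)" for u
  define x where "x = vec ?n (\<lambda>i. f (?w i))"
  have "p \<bullet> x = (\<Sum>i<?n. \<alpha> * (if ?w i \<in> A then p $ i else 0) + \<beta> * (if ?w i \<in> A then 0 else p $ i))"
    unfolding scalar_prod_def x_def by (auto simp: f_def atLeast0LessThan intro!: sum.cong)
  also have "\<dots> = \<alpha> * s + \<beta> * t" by (simp add: s_def t_def sum.distrib sum_distrib_left)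
  finally have "p \<bullet> x = 0" using orth by simp
  then have "x \<bullet> (adjacency_matrix G *\<^sub>v x) \<le> es ! 1 * (x \<bullet> x)"
    by (intro p(2)) (simp add: x_def)
  then have ineq: "d * (a * \<alpha>\<^sup>2 + b * \<beta>\<^sup>2) - m * (\<alpha> - \<beta>)\<^sup>2 \<le> es ! 1 * (a * \<alpha>\<^sup>2 + b * \<beta>\<^sup>2)"
    using cut_quadratic_form[OF reg psubset_imp_subset[OF A(2)], of \<alpha> \<beta>, folded f_def]
    unfolding x_def adjacency_matrix_quadratic_form a_def b_def m_def by simp
  have pos: "a * \<alpha>\<^sup>2 + b * \<beta>\<^sup>2 > 0"
    using ne ab by (auto intro: add_pos_nonneg add_nonneg_pos)
  have "(1 / a + 1 / b) * (a * \<alpha>\<^sup>2 + b * \<beta>\<^sup>2) - (\<alpha> - \<beta>)\<^sup>2 = (a * \<alpha> + b * \<beta>)\<^sup>2 / (a * b)"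
    using ab by (simp add: field_simps power2_eq_square)
  also have "\<dots> \<ge> 0" using ab by simp
  finally have "(\<alpha> - \<beta>)\<^sup>2 \<le> (1 / a + 1 / b) * (a * \<alpha>\<^sup>2 + b * \<beta>\<^sup>2)" by simp
  then have "m * (\<alpha> - \<beta>)\<^sup>2 \<le> m * ((1 / a + 1 / b) * (a * \<alpha>\<^sup>2 + b * \<beta>\<^sup>2))"
    by (rule mult_left_mono) (simp add: m_def)
  moreover have "(d - m * (1 / a + 1 / b)) * (a * \<alpha>\<^sup>2 + b * \<beta>\<^sup>2) =
      d * (a * \<alpha>\<^sup>2 + b * \<beta>\<^sup>2) - m * ((1 / a + 1 / b) * (a * \<alpha>\<^sup>2 + b * \<beta>\<^sup>2))"
    by (simp only: left_diff_distrib mult.assoc)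
  ultimately have "(d - m * (1 / a + 1 / b)) * (a * \<alpha>\<^sup>2 + b * \<beta>\<^sup>2) \<le> es ! 1 * (a * \<alpha>\<^sup>2 + b * \<beta>\<^sup>2)"
    using ineq by linarith
  then have "d - m * (1 / a + 1 / b) \<le> es ! 1" using pos by simp
  then show ?thesis by (simp add: eigval_def es_def a_def b_def m_def)
qed

section \<open>Toughness\<close>

text \<open>
  Double counting of the edges between \<open>S\<close> and the rest: the cuts around the components are disjoint,
  and each of their edges ends in \<open>S\<close>, which absorbs at most \<open>d\<close> edges per vertex.
\<close>
lemma component_cut_count:
  assumes reg: "regular G d"
    and cuts: "\<And>A. A \<noteq> {} \<Longrightarrow> A \<subset> verts G \<Longrightarrow> m \<le> card (edge_cut G A)"
    and S: "S \<subseteq> verts G" and sep: "num_components (G \<restriction> (verts G - S)) > 1"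
  shows "m * num_components (G \<restriction> (verts G - S)) \<le> d * card S"
proof -
  let ?H = "G \<restriction> (verts G - S)"
  interpret H: fin_digraph ?H
    by (rule fin_digraph_subgraph) (auto intro: induced_imp_subgraph induced_induce)
  let ?\<C> = "H.sccs_verts"
  have c: "num_components ?H = card ?\<C>" by (simp add: num_components_def H.card_sccs_verts)
  have sub: "C \<subseteq> verts G - S" "C \<noteq> {}" if "C \<in> ?\<C>" for C
    using H.sccs_verts_subsets[OF that] that by (auto simp: H.in_sccs_verts_conv_reachable)
  have proper: "C \<subset> verts G" if C: "C \<in> ?\<C>" for C
  proof -
    have "\<exists>D \<in> ?\<C>. D \<noteq> C"
    proof (rule ccontr)
      assume "\<not> ?thesis"
      then have "?\<C> \<subseteq> {C}" by blast
      then have "card ?\<C> \<le> card {C}" by (intro card_mono) auto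
      then show False using sep c by simp
    qed
    then obtain D where "D \<in> ?\<C>" "D \<noteq> C" by blast
    then show ?thesis using sub[of C] sub[of D] H.sccs_verts_disjoint[of C D] C by blast
  qed
  have into_S: "v \<in> S" if "C \<in> ?\<C>" "(u, v) \<in> edge_cut G C" for C u v
  proof (rule ccontr)
    assume "v \<notin> S"
    have uv: "u \<rightarrow>\<^bsub>G\<^esub> v" "u \<in> C" "v \<notin> C" using that by (auto simp: edge_cut_def)
    then have "u \<rightarrow>\<^bsub>?H\<^esub> v" "v \<rightarrow>\<^bsub>?H\<^esub> u"
      using \<open>v \<notin> S\<close> sub(1)[OF that(1)] dominates_sym[of u v] adj_in_verts[of u v]
      by (auto simp: arcs_ends_induce_subgraph)
    then have "u \<rightarrow>\<^sup>*\<^bsub>?H\<^esub> v" "v \<rightarrow>\<^sup>*\<^bsub>?H\<^esub> u" by auto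
    then show False using that(1) uv by (auto simp: H.in_sccs_verts_conv_reachable)
  qed
  have "m * card ?\<C> \<le> (\<Sum>C\<in>?\<C>. card (edge_cut G C))"
    using cuts sub proper sum_bounded_below[of ?\<C> m] by (simp add: mult.commute)
  also have "\<dots> = card (\<Union>C\<in>?\<C>. edge_cut G C)"
  proof (rule card_UN_disjoint[symmetric])
    show "\<forall>C\<in>?\<C>. \<forall>D\<in>?\<C>. C \<noteq> D \<longrightarrow> edge_cut G C \<inter> edge_cut G D = {}"
      using H.sccs_verts_disjoint unfolding edge_cut_def by blast
  qed (auto intro: H.finite_sccs_verts finite_edge_cut)
  also have "\<dots> \<le> card (prod.swap ` Sigma S (\<lambda>v. {u. v \<rightarrow>\<^bsub>G\<^esub> u}))"
  proof (rule card_mono)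
    show "(\<Union>C\<in>?\<C>. edge_cut G C) \<subseteq> prod.swap ` Sigma S (\<lambda>v. {u. v \<rightarrow>\<^bsub>G\<^esub> u})"
    proof clarify
      fix C u v assume C: "C \<in> ?\<C>" "(u, v) \<in> edge_cut G C"
      then have "v \<rightarrow>\<^bsub>G\<^esub> u" using dominates_sym[of u v] by (auto simp: edge_cut_def)
      then show "(u, v) \<in> prod.swap ` Sigma S (\<lambda>v. {u. v \<rightarrow>\<^bsub>G\<^esub> u})"
        using into_S[OF C] by (intro image_eqI[of _ _ "(v, u)"]) auto
    qed
    show "finite (prod.swap ` Sigma S (\<lambda>v. {u. v \<rightarrow>\<^bsub>G\<^esub> u}))"
      using finite_subset[OF S] finite_neighbours by auto
  qed
  also have "\<dots> = card (Sigma S (\<lambda>v. {u. v \<rightarrow>\<^bsub>G\<^esub> u}))" by (rule card_image) (auto intro: inj_onI)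
  also have "\<dots> = (\<Sum>v\<in>S. card {u. v \<rightarrow>\<^bsub>G\<^esub> u})"
    using finite_subset[OF S] finite_neighbours by simp
  also have "\<dots> = (\<Sum>v\<in>S. d)"
    using reg S by (intro sum.cong) (auto simp: card_neighbours regular_def)
  finally show ?thesis by (simp add: c mult.commute)
qed

lemma two_nonadjacent_vertices_two_components:
  assumes "u \<in> verts G" "v \<in> verts G" "u \<noteq> v" "\<not> u \<rightarrow>\<^bsub>G\<^esub> v"
  shows "num_components (G \<restriction> {u, v}) > 1"
proof -
  let ?H = "G \<restriction> {u, v}"
  interpret H: fin_digraph ?H
    using assms(1,2) by (intro fin_digraph_subgraph induced_imp_subgraph induced_induce) auto
  have "arcs_ends ?H = {}"
    using assms(4) dominates_sym[of u v] adj_not_same by (auto simp: arcs_ends_induce_subgraph)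
  then have "x \<rightarrow>\<^sup>*\<^bsub>?H\<^esub> y \<longleftrightarrow> x = y \<and> x \<in> {u, v}" for x y
    by (auto simp: H.reachable_conv)
  then have "{{u}, {v}} \<subseteq> H.sccs_verts"
    by (auto simp: H.in_sccs_verts_conv_reachable)
  then have "card {{u}, {v}} \<le> card H.sccs_verts"
    by (rule card_mono[OF H.finite_sccs_verts])
  then show ?thesis using assms(3) by (simp add: num_components_def H.card_sccs_verts)
qed

text \<open>
  Deleting all vertices but two nonadjacent ones leaves two components, so the minimum in the
  definition of toughness is taken over a nonempty set.
\<close>
lemma toughness_attained:
  assumes "u \<in> verts G" "v \<in> verts G" "u \<noteq> v" "\<not> u \<rightarrow>\<^bsub>G\<^esub> v"
  shows "\<exists>S. S \<subset> verts G \<and> num_components (G \<restriction> (verts G - S)) > 1 \<and>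
    toughness G = real (card S) / real (num_components (G \<restriction> (verts G - S)))"
proof -
  let ?T = "{real (card S) / real (num_components (G \<restriction> (verts G - S))) | S.
    S \<subset> verts G \<and> num_components (G \<restriction> (verts G - S)) > 1}"
  let ?S = "verts G - {u, v}"
  have "verts G - ?S = {u, v}" using assms by auto
  then have "num_components (G \<restriction> (verts G - ?S)) > 1"
    using two_nonadjacent_vertices_two_components[OF assms] by simp
  moreover have "?S \<subset> verts G" using assms(1) by blast
  ultimately have "real (card ?S) / real (num_components (G \<restriction> (verts G - ?S))) \<in> ?T"
    unfolding mem_Collect_eq by (intro exI[of _ ?S] conjI refl)
  then have "?T \<noteq> {}" by (metis empty_iff)
  moreover have "finite ?T"
    by (rule finite_subset[of _ "(\<lambda>S. real (card S) / real (num_components (G \<restriction> (verts G - S)))) ` Pow (verts G)"])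
      auto
  ultimately have "toughness G \<in> ?T" unfolding toughness_def by (intro Min_in)
  then show ?thesis by auto
qed

lemma toughness_ge_edge_connectivity:
  assumes reg: "regular G d" and d: "d > 0"
    and uv: "u \<in> verts G" "v \<in> verts G" "u \<noteq> v" "\<not> u \<rightarrow>\<^bsub>G\<^esub> v"
  shows "edge_connectivity G / d \<le> toughness G"
proof -
  obtain S where S: "S \<subset> verts G" "num_components (G \<restriction> (verts G - S)) > 1"
    "toughness G = real (card S) / real (num_components (G \<restriction> (verts G - S)))"
    using toughness_attained[OF uv] by blast
  let ?c = "num_components (G \<restriction> (verts G - S))"
  have "edge_connectivity G * ?c \<le> d * card S"
    using component_cut_count[OF reg edge_connectivity_le_cut psubset_imp_subset[OF S(1)] S(2)] .
  then have "real (edge_connectivity G) * ?c \<le> real d * card S"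
    by (metis of_nat_le_iff of_nat_mult)
  then show ?thesis unfolding S(3) using S(2) d by (simp add: field_simps)
qed

end

section \<open>Toughness of regular graphs with small edge connectivity\<close>

theorem corollary1p13:
  fixes G :: "('a, 'b) pre_digraph" and d :: nat
  assumes "graph G"
    and "Digraph_Component.connected G"
    and "regular G d"
    and "d \<ge> 3"
    and "edge_connectivity G < d"
  shows "toughness G > real d / eigval G 2 - 1 \<and>
         real d / eigval G 2 - 1 \<ge> real d / eigval_abs_max G - 1"
proof -
  interpret graph G by fact
  define k where "k = edge_connectivity G"
  obtain x where x: "x \<in> verts G"
    using assms(2) by (auto simp: Digraph_Component.connected_def strongly_connected_def)
  have deg: "card {v. x \<rightarrow>\<^bsub>G\<^esub> v} = d"
    using assms(3) x by (simp add: card_neighbours regular_def)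
  then have "{v. x \<rightarrow>\<^bsub>G\<^esub> v} \<noteq> {}" using assms(4) by (metis card.empty not_numeral_le_zero)
  then obtain y where "x \<rightarrow>\<^bsub>G\<^esub> y" by blast
  then have y: "y \<in> verts G" "x \<noteq> y" using adj_in_verts adj_not_same by blast+
  obtain A where A: "A \<noteq> {}" "A \<subset> verts G" "card (edge_cut G A) = k"
    using edge_connectivity_attained_by_cut[OF x y] unfolding k_def by (elim exE conjE)
  let ?B = "verts G - A"
  have kd: "k < d" using assms(5) by (simp add: k_def)
  have "k > 0"
    using connected_imp_edge_cut_nonempty[OF assms(2) A(1,2)] finite_edge_cut[of A] A(3)
    by (auto simp: card_gt_0_iff)
  have cA: "card A \<ge> d + 1"
    using small_cut_imp_large_side[OF assms(3) A(1)] A kd by auto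
  have "?B \<noteq> {}" using A(2) by blast
  moreover have "card (edge_cut G ?B) < d" using card_edge_cut_complement[of A] A(3) kd by simp
  ultimately have "d < card ?B" by (rule small_cut_imp_large_side[OF assms(3) _ Diff_subset])
  then have cB: "card ?B \<ge> d + 1" by simp
  \<comment> \<open>With at least \<open>2 d + 2\<close> vertices, \<open>x\<close> has a non-neighbour, so the toughness is attained.\<close>
  have "card (verts G) = card A + card ?B"
    using A(2) by (metis card_Diff_subset card_mono finite_subset finite_verts le_add_diff_inverse psubset_imp_subset)
  then have "card (insert x {v. x \<rightarrow>\<^bsub>G\<^esub> v}) < card (verts G)"
    using cA cB deg finite_neighbours[of x] by (simp add: card_insert_if)
  then have "\<not> verts G \<subseteq> insert x {v. x \<rightarrow>\<^bsub>G\<^esub> v}"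
    using card_mono[of "insert x {v. x \<rightarrow>\<^bsub>G\<^esub> v}" "verts G"] finite_neighbours[of x] by auto
  then obtain z where z: "z \<in> verts G" "x \<noteq> z" "\<not> x \<rightarrow>\<^bsub>G\<^esub> z" by blast
  have tough: "k / d \<le> toughness G"
    unfolding k_def using toughness_ge_edge_connectivity[OF assms(3) _ x z] assms(4) by simp
  \<comment> \<open>The bound on \<open>\<lambda>\<^sub>2\<close> when both sides of the cut have the least possible size \<open>d + 1\<close>.\<close>
  define \<mu> where "\<mu> = d - 2 * k / (d + 1 :: real)"
  have "1 / card A + 1 / card ?B \<le> 1 / (d + 1 :: real) + 1 / (d + 1 :: real)"
    using cA cB by (intro add_mono divide_left_mono) auto
  then have "k * (1 / card A + 1 / card ?B) \<le> k * (1 / (d + 1 :: real) + 1 / (d + 1 :: real))"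
    by (rule mult_left_mono) simp
  then have lam: "\<mu> \<le> eigval G 2"
    using second_eigenvalue_ge_cut[OF assms(3) A(1,2)] A(3) by (simp add: \<mu>_def algebra_simps)
  have "2 * real k < 2 * real d" using kd by simp
  also have "2 * real d = real d * 2" by simp
  also have "\<dots> \<le> real d * (real d - 1)" using assms(4) by (intro mult_left_mono) auto
  finally have small: "2 * real k < real d * (real d - 1)" .
  have mu_pos: "\<mu> > 0"
  proof -
    have "2 * real k < real d * (real d + 1)" using small by (simp add: algebra_simps)
    then show ?thesis by (simp add: \<mu>_def field_simps)
  qed
  have "real d / eigval G 2 \<le> real d / \<mu>"
    using lam mu_pos by (intro divide_left_mono) auto
  also have "\<dots> < k / d + 1"
  proof -
    have "(real k + d) * \<mu> - real d * d = k * (real d * (real d - 1) - 2 * k) / (d + 1)"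
      by (simp add: \<mu>_def field_simps)
    also have "\<dots> > 0" using small \<open>k > 0\<close> by simp
    finally show ?thesis using mu_pos assms(4) by (simp add: field_simps)
  qed
  finally have first: "toughness G > real d / eigval G 2 - 1" using tough by simp
  have "0 < eigval G 2" using lam mu_pos by simp
  moreover have "eigval G 2 \<le> eigval_abs_max G" unfolding eigval_abs_max_def by simp
  ultimately have "real d / eigval_abs_max G \<le> real d / eigval G 2"
    by (intro divide_left_mono) auto
  then show ?thesis using first by simp
qed

end
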